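(* Let $K$ be a proper cone of $\mathbb{R}^n$ and let $A\in\pi(K)$. For any nonnegative real number $\lambda$ and any positive integer $k$, the set $$F_{\lambda,k}=\{x\in K:\operatorname{sp}_A(x)\preceq(\lambda,k)\}$$ is an $A$-invariant face of $K$. Furthermore, for any nonnegative real numbers $\lambda_1,\lambda_2$ and positive integers $k_1,k_2$, if $(\lambda_1,k_1)\preceq(\lambda_2,k_2)$, then $F_{\lambda_1,k_1}\subseteq F_{\lambda_2,k_2}$.
   Context: A proper cone of $\mathbb{R}^n$ is a closed convex cone that is pointed ($K\cap(-K)=\{0\}$) and has nonempty interior. $\pi(K)$ is the set of real $n\times n$ matrices $A$ with $AK\subseteq K$. A face of $K$ is a convex subcone $F\subseteq K$ such that $x,y\in K$, $x+y\in F$ imply $x,y\in F$; it is $A$-invariant if $AF\subseteq F$. Spectral pairs: a generalized eigenvector of $A$ corresponding to $\lambda\in\mathbb{C}$ is a nonzero $x\in\mathbb{C}^n$ with $(\lambda I-A)^kx=0$ for some positive integer $k$; the least such $k$ is its order. A nonzero $x\in\mathbb{C}^n$ is written uniquely as $x=x_1+\dots+x_m$ with $x_i$ generalized eigenvectors of $A$ corresponding to distinct eigenvalues $\lambda_1,\dots,\lambda_m$. Then $\rho_x(A)=\max_i|\lambda_i|$, $\operatorname{ord}_A(x)$ is the maximum of the orders of those $x_i$ with $|\lambda_i|=\rho_x(A)$, and $\operatorname{sp}_A(x)=(\rho_x(A),\operatorname{ord}_A(x))$; also $\operatorname{sp}_A(0)=(0,0)$. The lexicographic ordering on pairs of reals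 is: $(\xi_1,\xi_2)\preceq(\eta_1,\eta_2)$ iff $\xi_1<\eta_1$, or $\xi_1=\eta_1$ and $\xi_2\le\eta_2$. *)

theory Defs
  imports "HOL-Analysis.Analysis"
begin

definition proper_cone :: "(real ^ 'n) set \<Rightarrow> bool" where
  "proper_cone K \<longleftrightarrow>
     convex_cone K \<and> closed K \<and> K \<inter> uminus ` K = {0} \<and> interior K \<noteq> {}"

definition cone_preserving :: "(real ^ 'n) set \<Rightarrow> (real ^ 'n ^ 'n) set" where
  "cone_preserving K = {A. (*v) A ` K \<subseteq> K}"

(* Faces in the sense of cone theory. The library's face_of is defined through
   open segments and also admits the empty set. *)
definition cone_face :: "'a::real_vector set \<Rightarrow> 'a set \<Rightarrow> bool" where
  "cone_face F K \<longleftrightarrow>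
     convex_cone F \<and> F \<subseteq> K \<and>
     (\<forall>x\<in>K. \<forall>y\<in>K. x + y \<in> F \<longrightarrow> x \<in> F \<and> y \<in> F)"

definition invariant_set :: "real ^ 'n ^ 'n \<Rightarrow> (real ^ 'n) set \<Rightarrow> bool" where
  "invariant_set A F \<longleftrightarrow> (*v) A ` F \<subseteq> F"

(* (mat l - A)^k x is written as a k-fold application, since the library has no
   matrix power on this type. *)
definition gen_eigenvector :: "complex ^ 'n ^ 'n \<Rightarrow> complex \<Rightarrow> complex ^ 'n \<Rightarrow> bool" where
  "gen_eigenvector A l x \<longleftrightarrow>
     x \<noteq> 0 \<and> (\<exists>k>0. ((*v) (mat l - A) ^^ k) x = 0)"

definition gen_eigenvector_order :: "complex ^ 'n ^ 'n \<Rightarrow> complex \<Rightarrow> complex ^ 'n \<Rightarrow> nat" where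
  "gen_eigenvector_order A l x = (LEAST k. 0 < k \<and> ((*v) (mat l - A) ^^ k) x = 0)"

(* A decomposition of x into generalized eigenvectors for distinct eigenvalues,
   encoded as the family c of components indexed by all complex numbers: c l is the
   summand belonging to l, and c l = 0 means that l does not occur in the sum. *)
definition gen_eigen_decomposition ::
    "complex ^ 'n ^ 'n \<Rightarrow> complex ^ 'n \<Rightarrow> (complex \<Rightarrow> complex ^ 'n) \<Rightarrow> bool" where
  "gen_eigen_decomposition A x c \<longleftrightarrow>
     finite {l. c l \<noteq> 0} \<and>
     (\<forall>l. c l \<noteq> 0 \<longrightarrow> gen_eigenvector A l (c l)) \<and>
     x = (\<Sum>l | c l \<noteq> 0. c l)"

(* The decomposition exists and is unique for every x. *)
definition gen_eigen_component ::
    "complex ^ 'n ^ 'n \<Rightarrow> complex ^ 'n \<Rightarrow> complex \<Rightarrow> complex ^ 'n" where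
  "gen_eigen_component A x = (THE c. gen_eigen_decomposition A x c)"

definition occurring_eigenvalues :: "complex ^ 'n ^ 'n \<Rightarrow> complex ^ 'n \<Rightarrow> complex set" where
  "occurring_eigenvalues A x = {l. gen_eigen_component A x l \<noteq> 0}"

(* local_spectral_radius and local_order are meaningful only for nonzero x;
   otherwise they are Max of the empty set. *)
definition local_spectral_radius :: "complex ^ 'n ^ 'n \<Rightarrow> complex ^ 'n \<Rightarrow> real" where
  "local_spectral_radius A x = Max (cmod ` occurring_eigenvalues A x)"

definition local_order :: "complex ^ 'n ^ 'n \<Rightarrow> complex ^ 'n \<Rightarrow> nat" where
  "local_order A x =
     Max {gen_eigenvector_order A l (gen_eigen_component A x l) | l.
            l \<in> occurring_eigenvalues A x \<and> cmod l = local_spectral_radius A x}"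

definition spectral_pair :: "complex ^ 'n ^ 'n \<Rightarrow> complex ^ 'n \<Rightarrow> real \<times> real" where
  "spectral_pair A x =
     (if x = 0 then (0, 0) else (local_spectral_radius A x, real (local_order A x)))"

(* Defined here because HOL-Analysis puts the componentwise order on pairs. *)
definition lex_le :: "real \<times> real \<Rightarrow> real \<times> real \<Rightarrow> bool" (infix "\<preceq>\<^sub>l\<^sub>e\<^sub>x" 50) where
  "p \<preceq>\<^sub>l\<^sub>e\<^sub>x q \<longleftrightarrow> fst p < fst q \<or> (fst p = fst q \<and> snd p \<le> snd q)"

definition complexify_vec :: "real ^ 'n \<Rightarrow> complex ^ 'n" where
  "complexify_vec x = (\<chi> i. of_real (x $ i))"

definition complexify_mat :: "real ^ 'n ^ 'n \<Rightarrow> complex ^ 'n ^ 'n" where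
  "complexify_mat A = map_matrix of_real A"

definition spectral_face ::
    "(real ^ 'n) set \<Rightarrow> real ^ 'n ^ 'n \<Rightarrow> real \<Rightarrow> nat \<Rightarrow> (real ^ 'n) set" where
  "spectral_face K A r k =
     {x \<in> K. spectral_pair (complexify_mat A) (complexify_vec x) \<preceq>\<^sub>l\<^sub>e\<^sub>x (r, real k)}"

end

theory Submission
  imports Defs "HOL-Computational_Algebra.Fundamental_Theorem_Algebra"
begin

text \<open>
  The spectral pair of \<open>x\<close> measures the growth of the orbit \<open>A\<^sup>m x\<close>: it is at most \<open>(r, k)\<close> iff
  \<open>\<parallel>A\<^sup>m x\<parallel> = O(m\<^bsup>k-1\<^esup> r\<^sup>m)\<close>. The vectors satisfying this bound form an
  invariant subspace, which gives invariance and the cone property. For the face property, a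
  closed pointed cone is normal, i.e. \<open>\<parallel>x\<parallel> \<le> c \<parallel>x + y\<parallel>\<close> on \<open>K\<close>; applied to \<open>A\<^sup>m x\<close> and
  \<open>A\<^sup>m y\<close>, it transfers the growth bound from \<open>x + y\<close> to \<open>x\<close>. The growth bound
  passes from a vector to its spectral components because every invariant subspace
  contains the components of its elements.
\<close>

subsection \<open>Generalized eigenspaces\<close>

abbreviation eig_shift :: "complex ^ 'n ^ 'n \<Rightarrow> complex \<Rightarrow> complex ^ 'n \<Rightarrow> complex ^ 'n" where
  "eig_shift B l \<equiv> (*v) (mat l - B)"

definition gen_eigenspace :: "complex ^ 'n ^ 'n \<Rightarrow> complex \<Rightarrow> (complex ^ 'n) set" where
  "gen_eigenspace B l = {x. \<exists>k. (eig_shift B l ^^ k) x = 0}"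

definition invariant_subspace :: "complex ^ 'n ^ 'n \<Rightarrow> (complex ^ 'n) set \<Rightarrow> bool" where
  "invariant_subspace B G \<longleftrightarrow> vec.subspace G \<and> (\<forall>x\<in>G. B *v x \<in> G)"

lemma mat_vector_mult: "mat l *v x = l *s (x :: 'a::comm_semiring_1 ^ 'n)"
  by (simp add: matrix_vector_mult_def mat_def vec_eq_iff if_distrib if_distribR sum.delta cong: if_cong)

lemma scale_inverse_cancel: "a \<noteq> 0 \<Longrightarrow> (1 / a) *s (a *s x) = (x :: 'a::field ^ 'n)"
  by simp

lemma eig_shift_eq: "eig_shift B l x = l *s x - B *v x"
  by (simp add: matrix_vector_mult_diff_rdistrib mat_vector_mult)

lemma eig_shift_commute: "eig_shift B l (eig_shift B m x) = eig_shift B m (eig_shift B l x)"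
  by (simp add: mat_vector_mult algebra_simps vector_scalar_commute vec.scale_right_diff_distrib mult.commute)

lemma funpow_apply_commute:
  assumes "\<And>x. f (g x) = g (f x)"
  shows "(f ^^ k) (g x) = g ((f ^^ k) x)"
  by (induction k) (simp_all add: assms)

lemma linear_funpow_matrix: "Vector_Spaces.linear (*s) (*s) ((*v) (M :: 'a::field ^ 'n ^ 'n) ^^ k)"
proof (induction k)
  case 0
  show ?case by unfold_locales (simp_all add: vec_eq_iff algebra_simps)
next
  case (Suc k)
  show ?case
    unfolding funpow.simps by (rule Vector_Spaces.linear_compose[OF Suc matrix_vector_mul_linear_gen])
qed

lemmas funpow_matrix_add = vec.linear_add[OF linear_funpow_matrix]
  and funpow_matrix_diff = vec.linear_diff[OF linear_funpow_matrix]
  and funpow_matrix_scale = vec.linear_scale[OF linear_funpow_matrix]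
  and funpow_matrix_0 = vec.linear_0[OF linear_funpow_matrix]
  and funpow_matrix_sum = vec.linear_sum[OF linear_funpow_matrix]

lemma funpow_eq_0_mono:
  assumes "((*v) (M :: 'a::field ^ 'n ^ 'n) ^^ k) x = 0" "k \<le> m"
  shows "((*v) M ^^ m) x = 0"
proof -
  have "((*v) M ^^ m) x = ((*v) M ^^ (m - k)) (((*v) M ^^ k) x)"
    using assms(2) by (simp flip: funpow_add comp_apply[of "(*v) M ^^ (m - k)"])
  then show ?thesis using assms(1) by (simp add: funpow_matrix_0)
qed

lemma gen_eigenspaceI: "(eig_shift B l ^^ k) x = 0 \<Longrightarrow> x \<in> gen_eigenspace B l"
  by (auto simp: gen_eigenspace_def)

lemma subspace_gen_eigenspace: "vec.subspace (gen_eigenspace B l)"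
proof (rule vec.subspaceI)
  show "0 \<in> gen_eigenspace B l"
    by (rule gen_eigenspaceI[where k = 0]) simp
next
  fix x y assume "x \<in> gen_eigenspace B l" "y \<in> gen_eigenspace B l"
  then obtain i j where "(eig_shift B l ^^ i) x = 0" "(eig_shift B l ^^ j) y = 0"
    by (auto simp: gen_eigenspace_def)
  then have "(eig_shift B l ^^ (i + j)) x = 0" "(eig_shift B l ^^ (i + j)) y = 0"
    by (auto intro: funpow_eq_0_mono)
  then show "x + y \<in> gen_eigenspace B l"
    by (intro gen_eigenspaceI[where k = "i + j"]) (simp add: funpow_matrix_add)
next
  fix c x assume "x \<in> gen_eigenspace B l"
  then show "c *s x \<in> gen_eigenspace B l"
    by (auto simp: gen_eigenspace_def funpow_matrix_scale)
qed

lemma gen_eigenspace_shift: "x \<in> gen_eigenspace B l \<Longrightarrow> eig_shift B m x \<in> gen_eigenspace B l"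
proof -
  assume "x \<in> gen_eigenspace B l"
  then obtain k where "(eig_shift B l ^^ k) x = 0"
    by (auto simp: gen_eigenspace_def)
  then show ?thesis
    by (intro gen_eigenspaceI[where k = k]) (simp add: funpow_apply_commute eig_shift_commute)
qed

lemma gen_eigenspace_unshift:
  "eig_shift B l x \<in> gen_eigenspace B l \<Longrightarrow> x \<in> gen_eigenspace B l"
proof -
  assume "eig_shift B l x \<in> gen_eigenspace B l"
  then obtain k where "(eig_shift B l ^^ k) (eig_shift B l x) = 0"
    by (auto simp: gen_eigenspace_def)
  then show ?thesis
    by (intro gen_eigenspaceI[where k = "Suc k"]) (simp add: funpow_swap1)
qed

lemma gen_eigenspace_funpow_shift:
  "x \<in> gen_eigenspace B l \<Longrightarrow> (eig_shift B m ^^ k) x \<in> gen_eigenspace B l"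
  by (induction k) (simp_all add: gen_eigenspace_shift)

section \<open>Invariant subspaces and components of their elements\<close>

lemma invariant_subspace_shift:
  assumes "invariant_subspace B G" "x \<in> G"
  shows "eig_shift B l x \<in> G"
  using assms unfolding eig_shift_eq invariant_subspace_def
  by (intro vec.subspace_diff vec.subspace_scale) auto

lemma invariant_subspace_funpow_shift:
  assumes "invariant_subspace B G" "x \<in> G"
  shows "(eig_shift B l ^^ k) x \<in> G"
  using assms by (induction k) (simp_all add: invariant_subspace_shift)

text \<open>On the generalized eigenspace of \<open>l\<close>, the map \<open>m - B\<close> is
  injective modulo \<open>G\<close>. Induction on the exponent of \<open>l - B\<close> that kills
  \<open>x\<close>: the induction hypothesis puts \<open>eig_shift B l x\<close> into
  \<open>G\<close>, and the difference of the two shifts of \<open>x\<close> is the nonzero multiple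
  \<open>(m - l) *s x\<close>.\<close>

lemma invariant_subspace_unshift:
  assumes G: "invariant_subspace B G" and "x \<in> gen_eigenspace B l"
    and "m \<noteq> l" "eig_shift B m x \<in> G"
  shows "x \<in> G"
proof -
  have "x \<in> G" if "(eig_shift B l ^^ k) x = 0" "eig_shift B m x \<in> G" for k x
    using that
  proof (induction k arbitrary: x)
    case 0
    then show ?case using G by (simp add: invariant_subspace_def vec.subspace_0)
  next
    case (Suc k)
    have "eig_shift B l x \<in> G"
    proof (rule Suc.IH)
      show "(eig_shift B l ^^ k) (eig_shift B l x) = 0"
        using Suc.prems(1) by (simp add: funpow_swap1)
      show "eig_shift B m (eig_shift B l x) \<in> G"
        using invariant_subspace_shift[OF G Suc.prems(2)] by (simp add: eig_shift_commute)
    qed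
    then have "eig_shift B m x - eig_shift B l x \<in> G"
      using G Suc.prems(2) by (auto simp: invariant_subspace_def intro: vec.subspace_diff)
    moreover have "eig_shift B m x - eig_shift B l x = (m - l) *s x"
      unfolding eig_shift_eq by (simp add: vec_eq_iff algebra_simps)
    ultimately have "(1 / (m - l)) *s ((m - l) *s x) \<in> G"
      using G by (metis invariant_subspace_def vec.subspace_scale)
    moreover have "(1 / (m - l)) *s ((m - l) *s x) = x"
      using \<open>m \<noteq> l\<close> by (intro scale_inverse_cancel) simp
    ultimately show ?case by (simp only:)
  qed
  note * = this
  obtain k where "(eig_shift B l ^^ k) x = 0"
    using assms(2) by (auto simp: gen_eigenspace_def)
  then show ?thesis using assms(4) by (rule *)
qed

lemma invariant_subspace_unshift_funpow:
  assumes G: "invariant_subspace B G" and x: "x \<in> gen_eigenspace B l"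
    and ne: "m \<noteq> l" and "(eig_shift B m ^^ k) x \<in> G"
  shows "x \<in> G"
  using assms(4)
proof (induction k)
  case (Suc k)
  then have "(eig_shift B m ^^ k) x \<in> G"
    by (intro invariant_subspace_unshift[OF G gen_eigenspace_funpow_shift[OF x] ne]) simp
  then show ?case by (rule Suc.IH)
qed simp

text \<open>With \<open>G = {0}\<close> this is the linear independence of generalized eigenspaces.\<close>

lemma component_in_invariant_subspace:
  assumes G: "invariant_subspace B G" and "finite S"
    and "\<And>l. l \<in> S \<Longrightarrow> c l \<in> gen_eigenspace B l" and "(\<Sum>l\<in>S. c l) \<in> G" and "l \<in> S"
  shows "c l \<in> G"
  using assms(2-)
proof (induction S arbitrary: c l rule: finite_induct)
  case (insert m S)
  obtain k where k: "(eig_shift B m ^^ k) (c m) = 0"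
    using insert.prems(1)[of m] by (auto simp: gen_eigenspace_def)
  \<comment> \<open>Applying \<open>m - B\<close> to the power \<open>k\<close> to the whole sum
    deletes the component of \<open>m\<close>. The induction hypothesis places the shifted remaining
    components in \<open>G\<close>, and since \<open>m\<close> differs from \<open>l\<close> the
    shifts can be undone.\<close>
  have *: "c l \<in> G" if l: "l \<in> S" for l
  proof (rule invariant_subspace_unshift_funpow[OF G])
    show "c l \<in> gen_eigenspace B l" using insert.prems(1) l by simp
    show "m \<noteq> l" using l insert.hyps by auto
    show "(eig_shift B m ^^ k) (c l) \<in> G"
    proof (rule insert.IH[OF _ _ l])
      show "(eig_shift B m ^^ k) (c l) \<in> gen_eigenspace B l" if "l \<in> S" for l
        using insert.prems(1) that by (simp add: gen_eigenspace_funpow_shift)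
      have "(eig_shift B m ^^ k) (\<Sum>l\<in>insert m S. c l) \<in> G"
        by (rule invariant_subspace_funpow_shift[OF G insert.prems(2)])
      then show "(\<Sum>l\<in>S. (eig_shift B m ^^ k) (c l)) \<in> G"
        using insert.hyps k by (simp add: funpow_matrix_sum funpow_matrix_add)
    qed
  qed
  show ?case
  proof (cases "l = m")
    case True
    have sub: "vec.subspace G" using G by (simp add: invariant_subspace_def)
    have "(\<Sum>l\<in>insert m S. c l) - (\<Sum>l\<in>S. c l) \<in> G"
      by (intro vec.subspace_diff[OF sub] insert.prems vec.subspace_sum[OF sub] *)
    then show ?thesis using insert.hyps True by simp
  next
    case False
    then show ?thesis using * insert.prems by simp
  qed
qed simp

section \<open>Existence of the decomposition into generalized eigenvectors\<close>

text \<open>Again the two shifts differ by the scalar \<open>m - l\<close>: if \<open>u\<close> is a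
  preimage of \<open>eig_shift B l y\<close>, which the induction hypothesis supplies, then
  \<open>y - u\<close> divided by \<open>m - l\<close> is a preimage of \<open>y\<close>.\<close>

lemma gen_eigenspace_shift_surj:
  assumes "y \<in> gen_eigenspace B l" "m \<noteq> l"
  shows "\<exists>x\<in>gen_eigenspace B l. eig_shift B m x = y"
proof -
  have "\<exists>x\<in>gen_eigenspace B l. eig_shift B m x = y" if "(eig_shift B l ^^ k) y = 0" for k y
    using that
  proof (induction k arbitrary: y)
    case 0
    then show ?case
      by (intro bexI[of _ 0]) (auto intro: gen_eigenspaceI[where k = 0])
  next
    case (Suc k)
    have y: "y \<in> gen_eigenspace B l" using Suc.prems by (rule gen_eigenspaceI)
    obtain u where u: "u \<in> gen_eigenspace B l" "eig_shift B m u = eig_shift B l y"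
      using Suc.IH[of "eig_shift B l y"] Suc.prems by (auto simp: funpow_swap1)
    let ?x = "(1 / (m - l)) *s (y - u)"
    have "eig_shift B m ?x = (1 / (m - l)) *s (eig_shift B m y - eig_shift B l y)"
      using u(2) by (simp add: vec.scale vec.diff del: vector_ssub_ldistrib)
    also have "eig_shift B m y - eig_shift B l y = (m - l) *s y"
      unfolding eig_shift_eq by (simp add: vec_eq_iff algebra_simps)
    also have "(1 / (m - l)) *s ((m - l) *s y) = y"
      using assms(2) by (intro scale_inverse_cancel) simp
    finally have "eig_shift B m ?x = y" .
    moreover have "?x \<in> gen_eigenspace B l"
      by (intro vec.subspace_scale vec.subspace_diff subspace_gen_eigenspace y u(1))
    ultimately show ?case by blast
  qed
  note * = this
  obtain k where "(eig_shift B l ^^ k) y = 0"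
    using assms(1) by (auto simp: gen_eigenspace_def)
  then show ?thesis by (rule *)
qed

definition poly_apply :: "complex ^ 'n ^ 'n \<Rightarrow> complex poly \<Rightarrow> complex ^ 'n \<Rightarrow> complex ^ 'n" where
  "poly_apply B p x = (\<Sum>i\<le>degree p. coeff p i *s ((*v) B ^^ i) x)"

lemma poly_apply_bound:
  assumes "degree p \<le> N"
  shows "poly_apply B p x = (\<Sum>i\<le>N. coeff p i *s ((*v) B ^^ i) x)"
  unfolding poly_apply_def
  by (rule sum.mono_neutral_left) (use assms in \<open>auto simp: coeff_eq_0\<close>)

text \<open>The product is \<open>- l\<close> times \<open>q\<close> plus \<open>q\<close> with its
  coefficients moved up by one place, and the latter amounts to one more application of
  \<open>B\<close>. The sign on the right appears because \<open>eig_shift\<close> is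
  \<open>l - B\<close> and not \<open>B - l\<close>.\<close>

lemma poly_apply_linear_factor:
  "poly_apply B ([:-l, 1:] * q) x = poly_apply B q (- eig_shift B l x)"
proof -
  have "[:-l, 1:] * q = smult (-l) q + pCons 0 q" by simp
  have "poly_apply B ([:-l, 1:] * q) x
      = (\<Sum>i\<le>Suc (degree q). coeff (smult (-l) q + pCons 0 q) i *s ((*v) B ^^ i) x)"
    unfolding \<open>[:-l, 1:] * q = _\<close>
    by (rule poly_apply_bound) (intro degree_add_le degree_pCons_le, simp)
  also have "\<dots> = (- l) *s (\<Sum>i\<le>Suc (degree q). coeff q i *s ((*v) B ^^ i) x)
      + (\<Sum>i\<le>Suc (degree q). coeff (pCons 0 q) i *s ((*v) B ^^ i) x)"
    unfolding vec.scale_sum_right sum.distrib[symmetric]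
    by (intro sum.cong) (simp_all add: vec_eq_iff algebra_simps)
  also have "(\<Sum>i\<le>Suc (degree q). coeff q i *s ((*v) B ^^ i) x) = poly_apply B q x"
    by (rule poly_apply_bound[symmetric]) simp
  also have "(\<Sum>i\<le>Suc (degree q). coeff (pCons 0 q) i *s ((*v) B ^^ i) x) = poly_apply B q (B *v x)"
    by (subst sum.atMost_Suc_shift) (simp add: poly_apply_def funpow_swap1)
  also have "(- l) *s poly_apply B q x + poly_apply B q (B *v x) = poly_apply B q (- eig_shift B l x)"
    unfolding poly_apply_def vec.scale_sum_right sum.distrib[symmetric] eig_shift_eq minus_diff_eq
    by (intro sum.cong refl)
       (simp add: funpow_matrix_diff funpow_matrix_scale vec_eq_iff algebra_simps)
  finally show ?thesis .
qed

text \<open>The first \<open>N + 1\<close> vectors of the orbit of \<open>x\<close> are linearly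
  dependent over the reals, \<open>N\<close> being the real dimension; the coefficients of a
  relation form \<open>p\<close>.\<close>

lemma annihilating_polynomial_exists:
  fixes B :: "complex ^ 'n ^ 'n"
  shows "\<exists>p. p \<noteq> 0 \<and> poly_apply B p x = 0"
proof -
  define f where "f i = ((*v) B ^^ i) x" for i
  define N where "N = DIM(complex ^ 'n)"
  have "\<exists>u::nat \<Rightarrow> real. (\<exists>i\<le>N. u i \<noteq> 0) \<and> (\<Sum>i\<le>N. u i *\<^sub>R f i) = 0"
  proof (cases "inj_on f {..N}")
    case True
    then have "card (f ` {..N}) = Suc N" by (simp add: card_image)
    then have "dependent (f ` {..N})"
      by (intro dependent_biggerset) (simp add: N_def)
    then obtain u v where "v \<in> f ` {..N}" "u v \<noteq> 0" "(\<Sum>v\<in>f ` {..N}. u v *\<^sub>R v) = 0"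
      by (auto simp: real_vector.dependent_finite)
    with True show ?thesis
      by (intro exI[of _ "u \<circ> f"]) (auto simp: sum.reindex)
  next
    \<comment> \<open>With repeated vectors the image set may be too small for the dimension count,
      but two equal iterates give a relation directly.\<close>
    case False
    then obtain i j where ij: "i \<le> N" "j \<le> N" "i \<noteq> j" "f i = f j"
      by (auto simp: inj_on_def)
    let ?u = "\<lambda>k. if k = i then 1 else if k = j then - 1 else (0::real)"
    have "(\<Sum>k\<le>N. ?u k *\<^sub>R f k) = (\<Sum>k\<in>{i, j}. ?u k *\<^sub>R f k)"
      by (rule sum.mono_neutral_right) (use ij in auto)
    also have "\<dots> = 0" using ij by simp
    finally show ?thesis using ij by (intro exI[of _ ?u]) auto
  qed
  then obtain u :: "nat \<Rightarrow> real" and j where u: "j \<le> N" "u j \<noteq> 0" "(\<Sum>i\<le>N. u i *\<^sub>R f i) = 0"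
    by blast
  define p where "p = (\<Sum>i\<le>N. monom (complex_of_real (u i)) i)"
  have coeff: "coeff p i = (if i \<le> N then complex_of_real (u i) else 0)" for i
    by (auto simp: p_def coeff_sum sum.delta if_distrib cong: if_cong)
  have "degree p \<le> N" by (rule degree_le) (simp add: coeff)
  then have "poly_apply B p x = (\<Sum>i\<le>N. u i *\<^sub>R f i)"
    by (subst poly_apply_bound)
       (auto intro!: sum.cong simp: coeff f_def vec_eq_iff scaleR_conv_of_real[where 'a = complex])
  moreover have "p \<noteq> 0" using coeff[of j] u by auto
  ultimately show ?thesis using u by auto
qed

text \<open>Induction on the degree of an annihilating polynomial. Splitting off a root
  \<open>m\<close> leaves \<open>q\<close>, which annihilates \<open>- eig_shift B m x\<close>, so
  this vector decomposes. Its components for \<open>l\<close> other than \<open>m\<close> are pulled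
  back through \<open>m - B\<close>; what remains of \<open>x\<close> belongs to
  \<open>m\<close>.\<close>

lemma sum_of_gen_eigenvectors:
  fixes B :: "complex ^ 'n ^ 'n"
  shows "\<exists>S c. finite S \<and> (\<forall>l. c l \<in> gen_eigenspace B l) \<and> x = (\<Sum>l\<in>S. c l)"
proof -
  have "\<exists>S c. finite S \<and> (\<forall>l. c l \<in> gen_eigenspace B l) \<and> x = (\<Sum>l\<in>S. c l)"
    if "p \<noteq> 0" "poly_apply B p x = 0" for p x
    using that
  proof (induction "degree p" arbitrary: p x)
    case 0
    then obtain a where "p = [:a:]" by (metis degree_eq_zeroE)
    with 0 have "x = 0" by (simp add: poly_apply_def)
    then show ?case
      by (intro exI[of _ "{}"] exI[of _ "\<lambda>_. 0"])
         (simp add: vec.subspace_0 subspace_gen_eigenspace)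
  next
    case (Suc d)
    have "\<not> constant (poly p)"
      using Suc.hyps(2) by (simp add: constant_degree)
    then obtain m where "poly p m = 0"
      using fundamental_theorem_of_algebra by blast
    then obtain q where q: "p = [:-m, 1:] * q"
      by (auto simp: poly_eq_0_iff_dvd dvd_def)
    with Suc.prems have "q \<noteq> 0" by auto
    then have "degree p = Suc (degree q)" unfolding q by (subst degree_mult_eq) auto
    then have "d = degree q" using Suc.hyps(2) by simp
    then obtain S c where Sc: "finite S" "\<And>l. c l \<in> gen_eigenspace B l"
      "- eig_shift B m x = (\<Sum>l\<in>S. c l)"
      using Suc.hyps(1)[of q "- eig_shift B m x"] Suc.prems(2) \<open>q \<noteq> 0\<close>
      unfolding q poly_apply_linear_factor by blast
    have "\<exists>e\<in>gen_eigenspace B l. eig_shift B m e = - c l" if "l \<noteq> m" for l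
      using that Sc(2) by (intro gen_eigenspace_shift_surj) (auto intro: vec.subspace_neg subspace_gen_eigenspace)
    then obtain e where e: "\<And>l. l \<noteq> m \<Longrightarrow> e l \<in> gen_eigenspace B l"
      "\<And>l. l \<noteq> m \<Longrightarrow> eig_shift B m (e l) = - c l"
      by metis
    \<comment> \<open>Removing the preimages \<open>e l\<close> leaves a vector whose shift by
      \<open>m\<close> is \<open>- c m\<close> or 0. Hence it lies in the generalized eigenspace of
      \<open>m\<close>, and then so does \<open>z\<close>.\<close>
    define z where "z = x - (\<Sum>l\<in>S - {m}. e l)"
    have "eig_shift B m z = eig_shift B m x + (\<Sum>l\<in>S - {m}. c l)"
      by (simp add: z_def vec.diff vec.sum e(2) sum_negf)
    also have "\<dots> = (if m \<in> S then - c m else 0)"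
      using Sc(1,3) by (auto simp: sum_diff1 algebra_simps neg_eq_iff_add_eq_0)
    also have "\<dots> \<in> gen_eigenspace B m"
      using Sc(2) subspace_gen_eigenspace by (auto intro: vec.subspace_neg vec.subspace_0)
    finally have z: "z \<in> gen_eigenspace B m" by (rule gen_eigenspace_unshift)
    have "x = (\<Sum>l\<in>insert m S. if l = m then z else e l)"
      using Sc(1) by (subst sum.insert_remove) (auto simp: z_def intro!: sum.cong)
    with e z Sc(1) show ?case
      by (intro exI[of _ "insert m S"] exI[of _ "\<lambda>l. if l = m then z else e l"]) auto
  qed
  with annihilating_polynomial_exists show ?thesis by blast
qed

section \<open>The decomposition in terms of components, and its uniqueness\<close>

lemma gen_eigenvector_iff: "gen_eigenvector B l x \<longleftrightarrow> x \<noteq> 0 \<and> x \<in> gen_eigenspace B l"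
proof -
  have "\<exists>k>0. (eig_shift B l ^^ k) x = 0" if "(eig_shift B l ^^ k) x = 0" for k
    by (rule exI[of _ "Suc k"]) (use funpow_eq_0_mono[OF that, of "Suc k"] in simp)
  then have "(\<exists>k>0. (eig_shift B l ^^ k) x = 0) \<longleftrightarrow> (\<exists>k. (eig_shift B l ^^ k) x = 0)" by metis
  then show ?thesis by (simp only: gen_eigenvector_def gen_eigenspace_def mem_Collect_eq)
qed

lemma gen_eigen_decomposition_in_gen_eigenspace:
  assumes "gen_eigen_decomposition B x c"
  shows "c l \<in> gen_eigenspace B l"
proof (cases "c l = 0")
  case True
  then show ?thesis by (simp add: vec.subspace_0 subspace_gen_eigenspace)
next
  case False
  then show ?thesis using assms by (simp add: gen_eigen_decomposition_def gen_eigenvector_iff)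
qed

lemma gen_eigen_decomposition_exists: "\<exists>c. gen_eigen_decomposition B x c"
proof -
  obtain S c where *: "finite S" "\<And>l. c l \<in> gen_eigenspace B l" "x = (\<Sum>l\<in>S. c l)"
    using sum_of_gen_eigenvectors by blast
  \<comment> \<open>The family is cut off outside \<open>S\<close>, where \<open>c\<close> may be
    nonzero, to make its support finite.\<close>
  let ?c = "\<lambda>l. if l \<in> S then c l else 0"
  have fin: "{l. ?c l \<noteq> 0} \<subseteq> S" by auto
  have "x = (\<Sum>l | ?c l \<noteq> 0. ?c l)"
    unfolding *(3) using *(1) by (intro sum.mono_neutral_cong_right) auto
  with * fin show ?thesis
    unfolding gen_eigen_decomposition_def
    by (intro exI[of _ ?c]) (auto simp: gen_eigenvector_iff intro: finite_subset)
qed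

text \<open>The difference of two decompositions sums to 0 over the union of their supports, and
  \<open>component_in_invariant_subspace\<close> for the zero subspace makes each term 0.\<close>

lemma gen_eigen_decomposition_unique:
  assumes "gen_eigen_decomposition B x c" "gen_eigen_decomposition B x d"
  shows "c = d"
proof
  fix l
  let ?S = "{l. c l \<noteq> 0} \<union> {l. d l \<noteq> 0}"
  have fin: "finite ?S" using assms by (simp add: gen_eigen_decomposition_def)
  note mem = gen_eigen_decomposition_in_gen_eigenspace[OF assms(1)]
    gen_eigen_decomposition_in_gen_eigenspace[OF assms(2)]
  have "(\<Sum>l | c l \<noteq> 0. c l) = (\<Sum>l\<in>?S. c l)" "(\<Sum>l | d l \<noteq> 0. d l) = (\<Sum>l\<in>?S. d l)"
    using fin by (auto intro!: sum.mono_neutral_left)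
  then have "x = (\<Sum>l\<in>?S. c l)" "x = (\<Sum>l\<in>?S. d l)"
    using assms unfolding gen_eigen_decomposition_def by metis+
  then have "(\<Sum>l\<in>?S. c l - d l) = 0" by (simp add: sum_subtractf)
  moreover have "invariant_subspace B {0}"
    by (simp add: invariant_subspace_def vec.subspace_single_0)
  ultimately have "c l - d l \<in> {0}" if "l \<in> ?S"
    by (intro component_in_invariant_subspace[of B _ ?S "\<lambda>l. c l - d l" l, OF _ fin _ _ that]
        vec.subspace_diff subspace_gen_eigenspace mem) simp_all
  then show "c l = d l" by (cases "c l = 0 \<and> d l = 0") auto
qed

lemma gen_eigen_component: "gen_eigen_decomposition B x (gen_eigen_component B x)"
proof -
  have "\<exists>!c. gen_eigen_decomposition B x c"
    using gen_eigen_decomposition_exists[of B x] gen_eigen_decomposition_unique by (rule ex_ex1I)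
  then show ?thesis
    unfolding gen_eigen_component_def by (rule theI')
qed

subsection \<open>Growth of orbits\<close>

text \<open>The bound is only required for \<open>m \<ge> k\<close>, so that for \<open>r = 0\<close> (where \<open>r ^ m = 0\<close>)
  the condition becomes \<open>B ^ k x = 0\<close> and no separate treatment of \<open>r = 0\<close> is needed.\<close>

definition growth_space :: "complex ^ 'n ^ 'n \<Rightarrow> real \<Rightarrow> nat \<Rightarrow> (complex ^ 'n) set" where
  "growth_space B r k =
     {x. \<exists>C. \<forall>m\<ge>k. norm (((*v) B ^^ m) x) \<le> C * (real m ^ (k - 1) * r ^ m)}"

lemma norm_vector_scalar: "norm (c *s x) = norm c * norm (x :: 'a::real_normed_field ^ 'n)"
  by (simp add: norm_vec_def L2_set_def norm_mult power_mult_distrib real_sqrt_mult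
      flip: sum_distrib_left)

lemma invariant_subspace_growth_space:
  assumes "0 \<le> r"
  shows "invariant_subspace B (growth_space B r k)"
  unfolding invariant_subspace_def
proof (intro conjI ballI vec.subspaceI)
  show "0 \<in> growth_space B r k"
    by (auto simp: growth_space_def funpow_matrix_0 intro: exI[of _ 0])
next
  fix x y assume "x \<in> growth_space B r k" "y \<in> growth_space B r k"
  then obtain C D where CD:
    "\<And>m. m \<ge> k \<Longrightarrow> norm (((*v) B ^^ m) x) \<le> C * (real m ^ (k - 1) * r ^ m)"
    "\<And>m. m \<ge> k \<Longrightarrow> norm (((*v) B ^^ m) y) \<le> D * (real m ^ (k - 1) * r ^ m)"
    by (auto simp: growth_space_def)
  have "norm (((*v) B ^^ m) (x + y)) \<le> (C + D) * (real m ^ (k - 1) * r ^ m)" if "m \<ge> k" for m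
    unfolding funpow_matrix_add distrib_right
    by (intro norm_triangle_mono CD that)
  then show "x + y \<in> growth_space B r k" by (auto simp: growth_space_def)
next
  fix c x assume "x \<in> growth_space B r k"
  then obtain C where C:
    "\<And>m. m \<ge> k \<Longrightarrow> norm (((*v) B ^^ m) x) \<le> C * (real m ^ (k - 1) * r ^ m)"
    by (auto simp: growth_space_def)
  have "norm (((*v) B ^^ m) (c *s x)) \<le> (norm c * C) * (real m ^ (k - 1) * r ^ m)" if "m \<ge> k" for m
    unfolding funpow_matrix_scale norm_vector_scalar mult.assoc[of "norm c"]
    by (intro mult_left_mono C that) simp
  then show "c *s x \<in> growth_space B r k" by (auto simp: growth_space_def)
next
  fix x assume "x \<in> growth_space B r k"
  then obtain C where C:
    "\<And>m. m \<ge> k \<Longrightarrow> norm (((*v) B ^^ m) x) \<le> C * (real m ^ (k - 1) * r ^ m)"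
    by (auto simp: growth_space_def)
  \<comment> \<open>Writing the \<open>m\<close>-th iterate of \<open>B *v x\<close> as
    \<open>B\<close> applied to the \<open>m\<close>-th iterate of \<open>x\<close> keeps the
    exponent \<open>m\<close>; only the constant grows, by the operator bound
    \<open>D\<close>.\<close>
  obtain D where D: "D > 0" "\<And>v. norm (B *v v) \<le> norm v * D"
    using bounded_linear.pos_bounded[OF matrix_vector_mul_bounded_linear[of B]] by blast
  have "norm (((*v) B ^^ m) (B *v x)) \<le> (C * D) * (real m ^ (k - 1) * r ^ m)" if "m \<ge> k" for m
  proof -
    have "norm (((*v) B ^^ m) (B *v x)) \<le> norm (((*v) B ^^ m) x) * D"
      using D(2) by (simp add: funpow_swap1[symmetric])
    also have "\<dots> \<le> C * (real m ^ (k - 1) * r ^ m) * D"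
      using C[OF that] D(1) by (intro mult_right_mono) auto
    finally show ?thesis by (simp add: mult_ac)
  qed
  then show "B *v x \<in> growth_space B r k" by (auto simp: growth_space_def)
qed

section \<open>Upper bounds for growth on a generalized eigenspace\<close>

text \<open>After division by \<open>r ^ m\<close> this is the exponential beating a power: the
  quotient tends to 0 and is therefore bounded.\<close>

lemma power_times_geometric_bounded:
  fixes s r :: real
  assumes "0 \<le> s" "s < r"
  shows "\<exists>C. \<forall>m. real m ^ j * s ^ m \<le> C * r ^ m"
proof -
  \<comment> \<open>Replacing \<open>s = 0\<close> by \<open>r / 2\<close> makes the base positive,
    so that its logarithm can be used.\<close>
  define t where "t = (if s = 0 then r / 2 else s)"
  have t: "0 < t" "t < r" "s \<le> t" using assms by (auto simp: t_def)
  define a where "a = - ln (t / r)"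
  have "0 < a" using t by (simp add: a_def ln_div)
  have q: "t / r = 1 / exp a" using t by (simp add: a_def exp_minus field_simps exp_diff ln_div)
  have "filterlim (\<lambda>m. a * real m) at_top sequentially"
    by (rule filterlim_tendsto_pos_mult_at_top[OF tendsto_const \<open>0 < a\<close> filterlim_real_sequentially])
  then have "(\<lambda>m. 1 / a ^ j * ((a * real m) ^ j / exp (a * real m))) \<longlonglongrightarrow> 1 / a ^ j * 0"
    by (intro tendsto_mult tendsto_const filterlim_compose[OF tendsto_power_div_exp_0])
  moreover have "1 / a ^ j * ((a * real m) ^ j / exp (a * real m)) = real m ^ j * (t / r) ^ m" for m
    unfolding q using \<open>0 < a\<close> by (simp add: power_mult_distrib power_divide flip: exp_of_nat2_mult)
  ultimately have "(\<lambda>m. real m ^ j * (t / r) ^ m) \<longlonglongrightarrow> 0" by simp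
  then have "Bseq (\<lambda>m. real m ^ j * (t / r) ^ m)"
    by (intro convergent_imp_Bseq) (auto simp: convergent_def)
  then obtain C where C: "\<And>m. norm (real m ^ j * (t / r) ^ m) \<le> C"
    unfolding Bseq_def by blast
  have "real m ^ j * s ^ m \<le> C * r ^ m" for m
  proof -
    have "real m ^ j * s ^ m \<le> real m ^ j * t ^ m"
      using assms t by (intro mult_left_mono power_mono) auto
    also have "\<dots> = (real m ^ j * (t / r) ^ m) * r ^ m"
      using t by (simp add: power_divide)
    also have "\<dots> \<le> C * r ^ m"
      using C[of m] t by (intro mult_right_mono) auto
    finally show ?thesis .
  qed
  then show ?thesis by blast
qed

text \<open>The coefficients in the binomial expansion of \<open>B\<^sup>m = (l - N)\<^sup>m\<close> with \<open>N = l - B\<close>.\<close>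

definition shift_coeff :: "complex \<Rightarrow> nat \<Rightarrow> nat \<Rightarrow> complex" where
  "shift_coeff l m j = of_nat (m choose j) * (-1) ^ j * l ^ (m - j)"

text \<open>Pascal's rule; the case split handles truncated subtraction in the exponent of
  \<open>l\<close>.\<close>

lemma shift_coeff_Suc_Suc: "shift_coeff l (Suc m) (Suc j) = l * shift_coeff l m (Suc j) - shift_coeff l m j"
proof (cases "Suc j \<le> m")
  case True
  then have "m - j = Suc (m - Suc j)" by simp
  then show ?thesis by (simp add: shift_coeff_def algebra_simps)
next
  case False
  then show ?thesis by (simp add: shift_coeff_def algebra_simps)
qed

lemma norm_shift_coeff: "norm (shift_coeff l m j) = real (m choose j) * norm l ^ (m - j)"
  by (simp add: shift_coeff_def norm_mult norm_power)

lemma funpow_eq_shift_sum: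
  "((*v) B ^^ m) x = (\<Sum>j\<le>m. shift_coeff l m j *s (eig_shift B l ^^ j) x)"
proof (induction m)
  case 0
  show ?case by (simp add: shift_coeff_def)
next
  case (Suc m)
  have B: "B *v v = l *s v - eig_shift B l v" for v by (simp add: eig_shift_eq)
  have "((*v) B ^^ Suc m) x = l *s (\<Sum>j\<le>m. shift_coeff l m j *s (eig_shift B l ^^ j) x)
      - (\<Sum>j\<le>m. shift_coeff l m j *s (eig_shift B l ^^ Suc j) x)"
    unfolding funpow.simps comp_apply Suc by (subst B) (simp add: vec.sum vec.scale)
  \<comment> \<open>The added term vanishes because \<open>m choose Suc m = 0\<close>; both sums can
    now be aligned after an index shift.\<close>
  also have "(\<Sum>j\<le>m. shift_coeff l m j *s (eig_shift B l ^^ j) x)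
      = (\<Sum>j\<le>Suc m. shift_coeff l m j *s (eig_shift B l ^^ j) x)"
    by (simp add: shift_coeff_def)
  also have "l *s \<dots> - (\<Sum>j\<le>m. shift_coeff l m j *s (eig_shift B l ^^ Suc j) x)
      = (l * shift_coeff l m 0) *s x + (\<Sum>j\<le>m. shift_coeff l (Suc m) (Suc j) *s (eig_shift B l ^^ Suc j) x)"
    unfolding sum.atMost_Suc_shift shift_coeff_Suc_Suc vec.scale_left_diff_distrib sum_subtractf
      vec.scale_right_distrib vec.scale_sum_right vec.scale_scale
    by simp
  also have "l * shift_coeff l m 0 = shift_coeff l (Suc m) 0"
    by (simp add: shift_coeff_def)
  finally show ?case unfolding sum.atMost_Suc_shift by simp
qed

text \<open>The number of terms no longer depends on \<open>m\<close>, which permits constants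
  uniform in \<open>m\<close>. Terms with \<open>j > m\<close> have coefficient 0.\<close>

lemma funpow_eq_shift_sum_order:
  assumes "(eig_shift B l ^^ d) x = 0"
  shows "((*v) B ^^ m) x = (\<Sum>j<d. shift_coeff l m j *s (eig_shift B l ^^ j) x)"
proof -
  have "(\<Sum>j\<le>m. shift_coeff l m j *s (eig_shift B l ^^ j) x)
      = (\<Sum>j\<in>{..m} \<inter> {..<d}. shift_coeff l m j *s (eig_shift B l ^^ j) x)"
    by (intro sum.mono_neutral_right) (auto intro!: funpow_eq_0_mono[OF assms] simp: not_less)
  also have "\<dots> = (\<Sum>j<d. shift_coeff l m j *s (eig_shift B l ^^ j) x)"
    by (intro sum.mono_neutral_left) (auto simp: shift_coeff_def)
  finally show ?thesis by (rule trans[OF funpow_eq_shift_sum])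
qed

lemma shift_coeff_bound:
  assumes "0 < k" "norm l < r \<or> norm l = r \<and> j < k"
  shows "\<exists>C. \<forall>m\<ge>k. norm (shift_coeff l m j) \<le> C * (real m ^ (k - 1) * r ^ m)"
  using assms(2)
proof
  assume l: "norm l = r \<and> j < k"
  have "norm (shift_coeff l m j) \<le> 1 / r ^ j * (real m ^ (k - 1) * r ^ m)" if "k \<le> m" for m
  proof -
    have "0 \<le> r" using l by auto
    have "real (m choose j) \<le> real (m ^ j)"
      using l that by (intro of_nat_mono binomial_le_pow) simp
    also have "\<dots> \<le> real m ^ (k - 1)"
      using l that assms(1) by (simp, intro power_increasing) auto
    finally have "norm (shift_coeff l m j) \<le> real m ^ (k - 1) * r ^ (m - j)"
      unfolding norm_shift_coeff using l \<open>0 \<le> r\<close> by (auto intro!: mult_right_mono)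
    \<comment> \<open>For \<open>r = 0\<close> both sides are 0, because \<open>j < k\<close> and
      \<open>k\<close> is at most \<open>m\<close>.\<close>
    also have "r ^ (m - j) = r ^ m / r ^ j"
      using l that by (cases "r = 0") (auto simp: power_diff power_0_left)
    finally show ?thesis by (simp add: field_simps)
  qed
  then show ?thesis by blast
next
  assume l: "norm l < r"
  \<comment> \<open>The midpoint is positive even when \<open>l = 0\<close>, so division by
    \<open>s ^ j\<close> is legitimate. The gap between \<open>s\<close> and \<open>r\<close>
    absorbs the factor \<open>real m ^ j\<close> for every \<open>j\<close>.\<close>
  define s where "s = (norm l + r) / 2"
  have "0 < r" using norm_ge_zero l by (rule le_less_trans)
  then have "0 < s" by (simp add: s_def add_nonneg_pos)
  with l have s: "norm l \<le> s" "s < r" "0 < s" by (simp_all add: s_def)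
  then obtain C where C: "\<And>m. real m ^ j * s ^ m \<le> C * r ^ m"
    using power_times_geometric_bounded[of s r j] by auto
  have C0: "0 \<le> C" using C[of 1] s by (simp add: zero_le_mult_iff) (smt (verit) mult_nonneg_nonneg mult_neg_pos zero_le_power)
  have "norm (shift_coeff l m j) \<le> C / s ^ j * (real m ^ (k - 1) * r ^ m)" if "k \<le> m" for m
  proof (cases "j \<le> m")
    case True
    have "real (m choose j) \<le> real (m ^ j)"
      using True by (intro of_nat_mono binomial_le_pow)
    then have "norm (shift_coeff l m j) \<le> real m ^ j * s ^ (m - j)"
      unfolding norm_shift_coeff using s by (intro mult_mono power_mono) auto
    also have "\<dots> = real m ^ j * s ^ m / s ^ j"
      using s True by (simp add: power_diff)
    also have "\<dots> \<le> C * r ^ m / s ^ j"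
      using C[of m] s by (intro divide_right_mono) auto
    also have "\<dots> = C / s ^ j * (1 * r ^ m)" by simp
    also have "\<dots> \<le> C / s ^ j * (real m ^ (k - 1) * r ^ m)"
      using C0 s that assms(1) by (intro mult_left_mono mult_right_mono one_le_power) auto
    finally show ?thesis .
  next
    case False
    then have "norm (shift_coeff l m j) = 0" by (simp add: norm_shift_coeff binomial_eq_0)
    also have "\<dots> \<le> C / s ^ j * (real m ^ (k - 1) * r ^ m)" using C0 s \<open>0 < r\<close> by simp
    finally show ?thesis .
  qed
  then show ?thesis by blast
qed

text \<open>The vectors \<open>v j\<close> are arbitrary so that this serves both for the whole
  expansion of an iterate and for its part below the leading term.\<close>

lemma shift_sum_bound:
  assumes "0 < k" "\<And>j. j < d \<Longrightarrow> norm l < r \<or> norm l = r \<and> j < k"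
  shows "\<exists>C. \<forall>m\<ge>k. norm (\<Sum>j<d. shift_coeff l m j *s v j) \<le> C * (real m ^ (k - 1) * r ^ m)"
proof -
  have "\<exists>C. \<forall>m\<ge>k. norm (shift_coeff l m j) \<le> C * (real m ^ (k - 1) * r ^ m)" if "j < d" for j
    by (rule shift_coeff_bound[OF assms(1) assms(2)[OF that]])
  then obtain C where C:
    "\<And>j m. j < d \<Longrightarrow> k \<le> m \<Longrightarrow> norm (shift_coeff l m j) \<le> C j * (real m ^ (k - 1) * r ^ m)"
    by metis
  have "norm (\<Sum>j<d. shift_coeff l m j *s v j) \<le> (\<Sum>j<d. C j * norm (v j)) * (real m ^ (k - 1) * r ^ m)"
    if "k \<le> m" for m
  proof -
    have "norm (\<Sum>j<d. shift_coeff l m j *s v j)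
        \<le> (\<Sum>j<d. C j * (real m ^ (k - 1) * r ^ m) * norm (v j))"
      using C that by (intro sum_norm_le) (auto simp: norm_vector_scalar intro: mult_right_mono)
    also have "\<dots> = (\<Sum>j<d. C j * norm (v j)) * (real m ^ (k - 1) * r ^ m)"
      unfolding sum_distrib_right by (simp add: mult_ac)
    finally show ?thesis .
  qed
  then show ?thesis by blast
qed

lemma gen_eigenspace_in_growth_space:
  assumes "0 < k" "x \<in> gen_eigenspace B l"
    and "norm l < r \<or> norm l = r \<and> (eig_shift B l ^^ k) x = 0"
  shows "x \<in> growth_space B r k"
proof -
  \<comment> \<open>On the circle \<open>norm l = r\<close> the length of the expansion must be
    \<open>k\<close>, to guarantee \<open>j < k\<close>; inside it any annihilating exponent will
    do.\<close>
  obtain d where d: "(eig_shift B l ^^ d) x = 0" "norm l < r \<or> norm l = r \<and> d = k"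
    using assms(2,3) by (auto simp: gen_eigenspace_def)
  show ?thesis
    unfolding growth_space_def mem_Collect_eq funpow_eq_shift_sum_order[OF d(1)]
    by (rule shift_sum_bound) (use d assms in auto)
qed

section \<open>Lower bounds for growth on a generalized eigenspace\<close>

lemma unbounded_above_nat: "\<not> (\<forall>m\<ge>k. real m \<le> D)"
proof
  assume *: "\<forall>m\<ge>k. real m \<le> D"
  obtain m where "D < real m" using reals_Archimedean2 by blast
  moreover have "real (m + k) \<le> D" using * le_add2 by blast
  ultimately show False by simp
qed

text \<open>A suitable shift \<open>w\<close> of \<open>x\<close> stays in the growth space by
  invariance, and its orbit has an explicit leading term. If the claim failed, this term would
  exceed the permitted bound by a factor of order \<open>m\<close>, which is unbounded.\<close>

lemma growth_space_gen_eigenvector: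
  assumes "0 \<le> r" "0 < k" "x \<in> gen_eigenspace B l" "x \<noteq> 0" "x \<in> growth_space B r k"
  shows "norm l < r \<or> norm l = r \<and> (eig_shift B l ^^ k) x = 0"
proof (rule ccontr)
  assume neg: "\<not> ?thesis"
  define d where "d = (LEAST i. (eig_shift B l ^^ i) x = 0)"
  have d: "(eig_shift B l ^^ d) x = 0"
    using assms(3) unfolding gen_eigenspace_def d_def by (auto intro: LeastI)
  have lt: "(eig_shift B l ^^ i) x \<noteq> 0" if "i < d" for i
    using not_less_Least[OF that[unfolded d_def]] .
  have "d \<noteq> 0" using d assms(4) by (cases d) auto
  note inv = invariant_subspace_growth_space[OF assms(1), of B k]
  show False
  proof (cases "norm l = r")
    case False
    then have r: "r < norm l" using neg by auto
    \<comment> \<open>One shift before annihilation, \<open>w\<close> is an eigenvector, so its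
      iterates are exactly \<open>l ^ m *s w\<close>.\<close>
    define w where "w = (eig_shift B l ^^ (d - 1)) x"
    have "w \<noteq> 0" using lt \<open>d \<noteq> 0\<close> by (simp add: w_def)
    have "(eig_shift B l ^^ 1) w = 0"
      using d \<open>d \<noteq> 0\<close> by (cases d) (simp_all add: w_def)
    from funpow_eq_shift_sum_order[OF this] have Bm: "((*v) B ^^ m) w = l ^ m *s w" for m
      by (simp add: shift_coeff_def)
    have "w \<in> growth_space B r k"
      unfolding w_def by (rule invariant_subspace_funpow_shift[OF inv assms(5)])
    then obtain C where C: "\<And>m. m \<ge> k \<Longrightarrow> norm l ^ m * norm w \<le> C * (real m ^ (k - 1) * r ^ m)"
      by (auto simp: growth_space_def Bm norm_vector_scalar norm_power)
    \<comment> \<open>The power is \<open>k\<close> instead of \<open>k - 1\<close>: the spare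
      factor \<open>real m\<close> is what becomes bounded below.\<close>
    obtain E where E: "\<And>m. real m ^ k * r ^ m \<le> E * norm l ^ m"
      using power_times_geometric_bounded[OF assms(1) r] by blast
    have "real m \<le> \<bar>C\<bar> * E / norm w" if "k \<le> m" for m
    proof -
      have pos: "0 < norm l ^ m" using r assms(1) by (intro zero_less_power) linarith
      have "norm l ^ m * (real m * norm w) = real m * (norm l ^ m * norm w)" by simp
      also have "\<dots> \<le> real m * (\<bar>C\<bar> * (real m ^ (k - 1) * r ^ m))"
        using assms(1) by (intro mult_left_mono order_trans[OF C[OF that]] mult_right_mono) auto
      also have "\<dots> = \<bar>C\<bar> * (real m ^ k * r ^ m)"
        using assms(2) by (cases k) auto
      also have "\<dots> \<le> \<bar>C\<bar> * (E * norm l ^ m)"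
        by (intro mult_left_mono E) simp
      also have "\<dots> = norm l ^ m * (\<bar>C\<bar> * E)" by simp
      finally have "real m * norm w \<le> \<bar>C\<bar> * E"
        using pos by (simp only: mult_le_cancel_left_pos)
      then show ?thesis using \<open>w \<noteq> 0\<close> by (simp add: field_simps)
    qed
    then show False using unbounded_above_nat by blast
  next
    case l: True
    with neg have "(eig_shift B l ^^ k) x \<noteq> 0" by simp
    then have "k < d" using funpow_eq_0_mono[OF d] by (meson not_less)
    \<comment> \<open>This shift has order exactly \<open>k + 1\<close>, so its expansion ends with
      the term \<open>j = k\<close>, of size about \<open>real m ^ k * r ^ m\<close>. The terms
      below it obey the permitted bound.\<close>
    define w where "w = (eig_shift B l ^^ (d - Suc k)) x"
    have shift_w: "(eig_shift B l ^^ j) w = (eig_shift B l ^^ (j + (d - Suc k))) x" for j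
      by (simp add: w_def funpow_add)
    have wk: "(eig_shift B l ^^ k) w \<noteq> 0" "(eig_shift B l ^^ Suc k) w = 0"
      using lt[of "d - 1"] d \<open>k < d\<close> unfolding shift_w by auto
    have "w \<in> growth_space B r k"
      unfolding w_def by (rule invariant_subspace_funpow_shift[OF inv assms(5)])
    then obtain C where C: "\<And>m. m \<ge> k \<Longrightarrow> norm (((*v) B ^^ m) w) \<le> C * (real m ^ (k - 1) * r ^ m)"
      by (auto simp: growth_space_def)
    obtain D where D: "\<And>m. m \<ge> k \<Longrightarrow> norm (\<Sum>j<k. shift_coeff l m j *s (eig_shift B l ^^ j) w)
        \<le> D * (real m ^ (k - 1) * r ^ m)"
      using shift_sum_bound[OF assms(2), of k l r "\<lambda>j. (eig_shift B l ^^ j) w"] l by blast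
    define W where "W = norm ((eig_shift B l ^^ k) w)"
    have W: "0 < W" using wk by (simp add: W_def)
    have main: "real (m choose k) * r ^ (m - k) * W \<le> (C + D) * (real m ^ (k - 1) * r ^ m)"
      if "k \<le> m" for m
    proof -
      have "shift_coeff l m k *s (eig_shift B l ^^ k) w
          = ((*v) B ^^ m) w - (\<Sum>j<k. shift_coeff l m j *s (eig_shift B l ^^ j) w)"
        unfolding funpow_eq_shift_sum_order[OF wk(2)] by simp
      then have "norm (shift_coeff l m k *s (eig_shift B l ^^ k) w)
          \<le> (C + D) * (real m ^ (k - 1) * r ^ m)"
        using norm_triangle_le_diff[OF add_mono[OF C[OF that] D[OF that]]]
        by (simp add: distrib_right)
      then show ?thesis by (simp add: norm_vector_scalar norm_shift_coeff W_def l)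
    qed
    \<comment> \<open>At \<open>m = k\<close> the left side of \<open>main\<close> is
      \<open>W\<close>, which is positive, while \<open>r = 0\<close> would make the right side
      0.\<close>
    have "r \<noteq> 0" using main[of k] W assms(2) by (auto simp: power_0_left)
    then have r: "0 < r" using assms(1) by simp
    have "real m \<le> (C + D) * r ^ k * real k ^ k / W" if "k \<le> m" for m
    proof -
      have m: "0 < real m ^ (k - 1)" "0 < r ^ m" using that assms(2) r by auto
      \<comment> \<open>The estimate \<open>(m / k) ^ k\<close> from below for
        \<open>m choose k\<close> supplies the full power \<open>real m ^ k\<close>.\<close>
      have "(real m ^ (k - 1) * r ^ m) * (real m * W) = real k ^ k * r ^ k * ((real m / real k) ^ k * r ^ (m - k) * W)"
        using that assms(2) r by (cases k) (auto simp: power_divide power_diff)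
      also have "\<dots> \<le> real k ^ k * r ^ k * (real (m choose k) * r ^ (m - k) * W)"
        using that r W by (intro mult_left_mono mult_right_mono binomial_ge_n_over_k_pow_k) auto
      also have "\<dots> \<le> real k ^ k * r ^ k * ((C + D) * (real m ^ (k - 1) * r ^ m))"
        using main[OF that] r by (intro mult_left_mono) auto
      also have "\<dots> = (real m ^ (k - 1) * r ^ m) * ((C + D) * r ^ k * real k ^ k)" by simp
      finally have "real m * W \<le> (C + D) * r ^ k * real k ^ k"
        using m by (simp only: mult_le_cancel_left_pos mult_pos_pos)
      then show ?thesis using W by (simp add: field_simps)
    qed
    then show False using unbounded_above_nat by blast
  qed
qed

section \<open>Spectral pairs as growth bounds\<close>

lemma gen_eigenvector_order_le_iff:
  assumes "gen_eigenvector B l x" "0 < k"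
  shows "gen_eigenvector_order B l x \<le> k \<longleftrightarrow> (eig_shift B l ^^ k) x = 0"
proof
  have "\<exists>i. 0 < i \<and> (eig_shift B l ^^ i) x = 0"
    using assms(1) by (auto simp: gen_eigenvector_def)
  then have "(eig_shift B l ^^ gen_eigenvector_order B l x) x = 0"
    unfolding gen_eigenvector_order_def by (rule LeastI2_ex) simp
  then show "(eig_shift B l ^^ k) x = 0" if "gen_eigenvector_order B l x \<le> k"
    using that by (rule funpow_eq_0_mono)
  show "gen_eigenvector_order B l x \<le> k" if "(eig_shift B l ^^ k) x = 0"
    unfolding gen_eigenvector_order_def using that assms(2) by (intro Least_le) simp
qed

lemma gen_eigen_component_zero: "gen_eigen_component B 0 = (\<lambda>_. 0)"
  by (rule gen_eigen_decomposition_unique[OF gen_eigen_component])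
     (simp add: gen_eigen_decomposition_def)

text \<open>Both maxima in the spectral pair dissolve into a condition on each component separately,
  which is the form that the growth estimates can use.\<close>

lemma spectral_pair_le_iff:
  assumes "0 \<le> r" "0 < k"
  shows "spectral_pair B x \<preceq>\<^sub>l\<^sub>e\<^sub>x (r, real k) \<longleftrightarrow>
    (\<forall>l. gen_eigen_component B x l \<noteq> 0 \<longrightarrow>
       norm l < r \<or> norm l = r \<and> (eig_shift B l ^^ k) (gen_eigen_component B x l) = 0)"
proof (cases "x = 0")
  \<comment> \<open>The zero vector has no components, and its pair \<open>(0, 0)\<close> lies below
    \<open>(r, k)\<close>.\<close>
  case True
  then show ?thesis using assms by (auto simp: spectral_pair_def lex_le_def gen_eigen_component_zero)
next
  case False
  define c where "c = gen_eigen_component B x"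
  define S where "S = {l. c l \<noteq> 0}"
  define ord where "ord l = gen_eigenvector_order B l (c l)" for l
  define \<rho> where "\<rho> = local_spectral_radius B x"
  have dec: "gen_eigen_decomposition B x c" unfolding c_def by (rule gen_eigen_component)
  then have fin: "finite S" by (simp add: gen_eigen_decomposition_def S_def)
  have "x = (\<Sum>l\<in>S. c l)" using dec unfolding gen_eigen_decomposition_def S_def by simp
  then have "S \<noteq> {}" using False by auto
  have S: "occurring_eigenvalues B x = S"
    by (simp add: occurring_eigenvalues_def S_def c_def)
  have \<rho>: "\<rho> = Max (norm ` S)" by (simp add: \<rho>_def local_spectral_radius_def S)
  have \<rho>_ge: "norm l \<le> \<rho>" if "l \<in> S" for l using that fin by (simp add: \<rho>)
  have "\<rho> \<in> norm ` S" unfolding \<rho> using fin \<open>S \<noteq> {}\<close> by (intro Max_in) auto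
  then obtain l0 where l0: "l0 \<in> S" "norm l0 = \<rho>" by auto
  have lo: "local_order B x = Max (ord ` {l \<in> S. norm l = \<rho>})"
    unfolding local_order_def S \<rho>_def[symmetric]
    by (rule arg_cong[of _ _ Max]) (auto simp: ord_def c_def)
  have "local_order B x \<le> k \<longleftrightarrow> (\<forall>l\<in>S. norm l = \<rho> \<longrightarrow> ord l \<le> k)"
    unfolding lo using fin l0 by (subst Max_le_iff) auto
  moreover have "ord l \<le> k \<longleftrightarrow> (eig_shift B l ^^ k) (c l) = 0" if "l \<in> S" for l
    using that dec assms(2) unfolding ord_def S_def gen_eigen_decomposition_def
    by (intro gen_eigenvector_order_le_iff) auto
  ultimately have *: "local_order B x \<le> k \<longleftrightarrow> (\<forall>l\<in>S. norm l = \<rho> \<longrightarrow> (eig_shift B l ^^ k) (c l) = 0)"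
    by simp
  have "spectral_pair B x \<preceq>\<^sub>l\<^sub>e\<^sub>x (r, real k) \<longleftrightarrow> \<rho> < r \<or> \<rho> = r \<and> local_order B x \<le> k"
    using False by (simp add: spectral_pair_def lex_le_def \<rho>_def)
  \<comment> \<open>From right to left, \<open>l0\<close> decides the case: the maximum is attained
    there, so its condition gives either \<open>\<rho> < r\<close> or
    \<open>\<rho> = r\<close>.\<close>
  also have "\<dots> \<longleftrightarrow> (\<forall>l\<in>S. norm l < r \<or> norm l = r \<and> (eig_shift B l ^^ k) (c l) = 0)"
    unfolding * using \<rho>_ge l0 by (smt (verit, ccfv_threshold))
  finally show ?thesis by (simp add: S_def c_def)
qed

text \<open>A vector lies in the growth space iff all its components do: one direction is
  \<open>component_in_invariant_subspace\<close>, the other closure under sums. For single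
  components both implications are proved above.\<close>

lemma spectral_pair_le_iff_growth:
  assumes "0 \<le> r" "0 < k"
  shows "spectral_pair B x \<preceq>\<^sub>l\<^sub>e\<^sub>x (r, real k) \<longleftrightarrow> x \<in> growth_space B r k"
proof -
  define c where "c = gen_eigen_component B x"
  have dec: "gen_eigen_decomposition B x c" unfolding c_def by (rule gen_eigen_component)
  then have fin: "finite {l. c l \<noteq> 0}" and sum: "x = (\<Sum>l | c l \<noteq> 0. c l)"
    by (simp_all add: gen_eigen_decomposition_def)
  note mem = gen_eigen_decomposition_in_gen_eigenspace[OF dec]
  note inv = invariant_subspace_growth_space[OF assms(1), of B k]
  have "x \<in> growth_space B r k \<longleftrightarrow> (\<forall>l. c l \<noteq> 0 \<longrightarrow> c l \<in> growth_space B r k)"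
  proof (intro iffI allI impI)
    fix l assume "x \<in> growth_space B r k" "c l \<noteq> 0"
    then show "c l \<in> growth_space B r k"
      using sum by (intro component_in_invariant_subspace[OF inv fin mem]) auto
  next
    assume "\<forall>l. c l \<noteq> 0 \<longrightarrow> c l \<in> growth_space B r k"
    then have "(\<Sum>l | c l \<noteq> 0. c l) \<in> growth_space B r k"
      using inv by (intro vec.subspace_sum) (auto simp: invariant_subspace_def)
    then show "x \<in> growth_space B r k" using sum by simp
  qed
  also have "\<dots> \<longleftrightarrow> (\<forall>l. c l \<noteq> 0 \<longrightarrow>
      norm l < r \<or> norm l = r \<and> (eig_shift B l ^^ k) (c l) = 0)"
    using gen_eigenspace_in_growth_space[OF assms(2) mem]
      growth_space_gen_eigenvector[OF assms mem] by blast
  finally show ?thesis unfolding spectral_pair_le_iff[OF assms] c_def by simp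
qed

subsection \<open>Faces of an invariant cone\<close>

lemma norm_complexify_vec: "norm (complexify_vec x) = norm x"
  by (simp add: norm_vec_def L2_set_def complexify_vec_def)

lemma funpow_complexify:
  "((*v) (complexify_mat A) ^^ m) (complexify_vec x) = complexify_vec (((*v) A ^^ m) x)"
proof (induction m)
  case (Suc m)
  have "complexify_mat A *v complexify_vec y = complexify_vec (A *v y)" for y
    by (simp add: complexify_mat_def complexify_vec_def matrix_vector_mult_def map_matrix_def vec_eq_iff)
  then show ?case by (simp add: Suc)
qed simp

lemma mem_spectral_face_iff:
  assumes "0 \<le> r" "0 < k"
  shows "x \<in> spectral_face K A r k \<longleftrightarrow>
    x \<in> K \<and> (\<exists>C. \<forall>m\<ge>k. norm (((*v) A ^^ m) x) \<le> C * (real m ^ (k - 1) * r ^ m))"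
  unfolding spectral_face_def mem_Collect_eq spectral_pair_le_iff_growth[OF assms]
  by (simp add: growth_space_def funpow_complexify norm_complexify_vec)

lemma complexify_vec_add: "complexify_vec (x + y) = complexify_vec x + complexify_vec y"
  by (simp add: complexify_vec_def vec_eq_iff)

lemma complexify_vec_scaleR: "complexify_vec (c *\<^sub>R x) = of_real c *s complexify_vec x"
  by (simp add: complexify_vec_def vec_eq_iff)

text \<open>This form gives access to the subspace properties, whereas
  \<open>mem_spectral_face_iff\<close> gives the norm bounds needed for the face property.\<close>

lemma spectral_face_eq_growth:
  assumes "0 \<le> r" "0 < k"
  shows "spectral_face K A r k = {x \<in> K. complexify_vec x \<in> growth_space (complexify_mat A) r k}"
  unfolding spectral_face_def spectral_pair_le_iff_growth[OF assms] ..

lemma proper_cone_normal: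
  fixes K :: "(real ^ 'n) set"
  assumes "proper_cone K"
  obtains d where "0 < d" "\<And>x y. x \<in> K \<Longrightarrow> y \<in> K \<Longrightarrow> d * norm x \<le> norm (x + y)"
proof -
  have cone: "convex_cone K" and closed: "closed K" and pointed: "K \<inter> uminus ` K = {0}"
    using assms by (auto simp: proper_cone_def)
  have "compact (K \<inter> sphere 0 1)"
    using closed by (intro closed_Int_compact) auto
  moreover have "closed (uminus ` K)" using closed by (rule closed_negations)
  moreover have "(K \<inter> sphere 0 1) \<inter> uminus ` K \<subseteq> {0} \<inter> sphere 0 1"
    using pointed by blast
  then have "(K \<inter> sphere 0 1) \<inter> uminus ` K = {}" by simp
  ultimately have "\<exists>d>0. \<forall>x\<in>K \<inter> sphere 0 1. \<forall>y\<in>uminus ` K. d \<le> dist x y"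
    by (rule separate_compact_closed)
  then obtain d where d: "0 < d"
    "\<And>x y. x \<in> K \<inter> sphere 0 1 \<Longrightarrow> y \<in> uminus ` K \<Longrightarrow> d \<le> dist x y"
    by blast
  have "d * norm x \<le> norm (x + y)" if "x \<in> K" "y \<in> K" for x y
  proof (cases "x = 0")
    case False
    have "inverse (norm x) *\<^sub>R x \<in> K \<inter> sphere 0 1" "- (inverse (norm x) *\<^sub>R y) \<in> uminus ` K"
      using that False cone by (auto intro!: convex_cone_scaleR imageI)
    then have "d \<le> dist (inverse (norm x) *\<^sub>R x) (- (inverse (norm x) *\<^sub>R y))"
      by (rule d(2))
    also have "\<dots> = norm (inverse (norm x) *\<^sub>R (x + y))"
      by (simp add: dist_norm scaleR_add_right)
    also have "\<dots> = norm (x + y) / norm x"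
      unfolding norm_scaleR by (simp add: divide_inverse)
    finally show ?thesis using False by (simp add: field_simps)
  qed simp
  with d(1) that show thesis by blast
qed

lemma cone_face_spectral_face:
  assumes K: "proper_cone K" and A: "A \<in> cone_preserving K" and rk: "0 \<le> r" "0 < k"
  shows "cone_face (spectral_face K A r k) K"
  unfolding cone_face_def
proof (intro conjI ballI impI)
  have cone: "convex_cone K" using K by (simp add: proper_cone_def)
  have sub: "vec.subspace (growth_space (complexify_mat A) r k)"
    using invariant_subspace_growth_space[OF rk(1)] by (auto simp: invariant_subspace_def)
  have zero: "complexify_vec 0 = 0" by (simp add: complexify_vec_def vec_eq_iff)
  show "convex_cone (spectral_face K A r k)"
    unfolding convex_cone_iff spectral_face_eq_growth[OF rk]
    using cone sub
    by (auto simp: zero complexify_vec_add complexify_vec_scaleR convex_cone_contains_0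
        intro: convex_cone_add convex_cone_scaleR vec.subspace_add vec.subspace_scale vec.subspace_0)
  show "spectral_face K A r k \<subseteq> K" by (auto simp: spectral_face_def)
  \<comment> \<open>Both orbits stay in \<open>K\<close>, so normality applies to the iterates with
    one \<open>d\<close> for all \<open>m\<close>.\<close>
  have pow: "((*v) A ^^ m) z \<in> K" if "z \<in> K" for z m
    using that A by (induction m) (auto simp: cone_preserving_def)
  obtain d where d: "0 < d" "\<And>x y. x \<in> K \<Longrightarrow> y \<in> K \<Longrightarrow> d * norm x \<le> norm (x + y)"
    using proper_cone_normal[OF K] by blast
  have face: "x \<in> spectral_face K A r k"
    if xy: "x \<in> K" "y \<in> K" "x + y \<in> spectral_face K A r k" for x y
  proof -
    obtain C where C: "\<And>m. m \<ge> k \<Longrightarrow>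
        norm (((*v) A ^^ m) (x + y)) \<le> C * (real m ^ (k - 1) * r ^ m)"
      using xy(3) unfolding mem_spectral_face_iff[OF rk] by blast
    have "norm (((*v) A ^^ m) x) \<le> C / d * (real m ^ (k - 1) * r ^ m)" if "k \<le> m" for m
    proof -
      have "d * norm (((*v) A ^^ m) x) \<le> C * (real m ^ (k - 1) * r ^ m)"
        using d(2)[OF pow pow, OF xy(1,2), of m m] C[OF that] by (simp add: funpow_matrix_add)
      then show ?thesis using d(1) by (simp add: field_simps)
    qed
    then show ?thesis using xy(1) unfolding mem_spectral_face_iff[OF rk] by blast
  qed
  fix x y assume xy: "x \<in> K" "y \<in> K" "x + y \<in> spectral_face K A r k"
  then show "x \<in> spectral_face K A r k" by (rule face)
  show "y \<in> spectral_face K A r k" using face[of y x] xy by (simp add: add.commute)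
qed

lemma invariant_set_spectral_face:
  assumes "A \<in> cone_preserving K" "0 \<le> r" "0 < k"
  shows "invariant_set A (spectral_face K A r k)"
proof -
  have "complexify_vec (A *v x) = complexify_mat A *v complexify_vec x" for x
    using funpow_complexify[of 1 A x] by simp
  then have "complexify_vec (A *v x) \<in> growth_space (complexify_mat A) r k"
    if "complexify_vec x \<in> growth_space (complexify_mat A) r k" for x
    using that invariant_subspace_growth_space[OF assms(2), of "complexify_mat A" k]
    by (simp add: invariant_subspace_def)
  then show ?thesis
    using assms(1)
    by (auto simp: invariant_set_def spectral_face_eq_growth[OF assms(2,3)] cone_preserving_def)
qed

text \<open>Monotonicity of the faces in \<open>(r, k)\<close> rests on this.\<close>

lemma lex_le_trans: "p \<preceq>\<^sub>l\<^sub>e\<^sub>x q \<Longrightarrow> q \<preceq>\<^sub>l\<^sub>e\<^sub>x s \<Longrightarrow> p \<preceq>\<^sub>l\<^sub>e\<^sub>x s"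
  by (auto simp: lex_le_def)

theorem corollary4p10:
  fixes K :: "(real ^ 'n) set" and A :: "real ^ 'n ^ 'n"
  assumes "proper_cone K" and "A \<in> cone_preserving K"
  shows "(\<forall>(r::real) (k::nat). 0 \<le> r \<longrightarrow> 0 < k \<longrightarrow>
            cone_face (spectral_face K A r k) K \<and> invariant_set A (spectral_face K A r k))
       \<and> (\<forall>(r1::real) (r2::real) (k1::nat) (k2::nat).
            0 \<le> r1 \<longrightarrow> 0 \<le> r2 \<longrightarrow> 0 < k1 \<longrightarrow> 0 < k2 \<longrightarrow>
            (r1, real k1) \<preceq>\<^sub>l\<^sub>e\<^sub>x (r2, real k2) \<longrightarrow>
            spectral_face K A r1 k1 \<subseteq> spectral_face K A r2 k2)"
  using cone_face_spectral_face[OF assms] invariant_set_spectral_face[OF assms(2)]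
  by (auto simp: spectral_face_def intro: lex_le_trans)

end
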